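(* Let $f:\mathbb{R}^n\to\mathbb{R}$ be continuously differentiable, let its gradient $g=\nabla f$ be Lipschitz continuous with constant $L\ge 0$ (that is, $\|g(x)-g(y)\|\le L\|x-y\|$ for all $x,y\in\mathbb{R}^n$), and suppose there is a constant $f_{\rm low}$ with $f(x)\ge f_{\rm low}$ for all $x\in\mathbb{R}^n$. Let $T\in\{2,\dots,n\}$ and let $\varsigma\in(0,1)$ satisfy $\varsigma\le\left(\frac{8nL}{3}\right)^2$. Let $\{x_k\}_{k\ge0}$ be a sequence of iterates generated by the prunAdag algorithm (described in the context) applied to $\min_{x\in\mathbb{R}^n} f(x)$ with parameters $T$ and $\varsigma$, where the set $\mathcal{R}_k$ of relevant indices has cardinality exactly $T$ for every $k\ge 0$. Suppose that the sequence of iterates is bounded in the sense that, for some $\kappa_x>0$, $|x_{i,k}|\le\kappa_x$ for every $i\in\{1,\dots,n\}$ and all $k\ge0$. Define $\Gamma_0 = f(x_0)-f_{\rm low}$. Then, for every $k\ge 0$, $$ \frac{1}{k+1}\sum_{j=0}^k\|g(x_j)\|^2\le \left\lceil \frac{n}{T}\right\rceil\frac{\theta(k)}{k+1}, $$ where $$ \theta(k)=\max\left\{\varsigma,\ \frac{\varsigma}{2}e^{\frac{\Gamma_0}{nL}},\ 32n^2L^2\left|W_{-1}\left(-\frac{\sqrt{\varsigma}}{8nL}\right)\right|^2,\ 2\left(\Gamma_0+nL\log\left(1+\frac{(k+1)\kappa_x^2}{\varsigma}\right)\right)^2\right\} $$ and $W_{-1}$ is the second real branch of the Lambert function.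
   Context: Notation: $\|\cdot\|$ is the Euclidean norm; $v_{i,k}$ is the $i$-th component of $v_k\in\mathbb{R}^n$; $g_k=g(x_k)$; complements $A^C$ are taken in $\{1,\dots,n\}$; $\lceil\cdot\rceil$ is the ceiling function. $W_{-1}$ is the real branch of the Lambert function on $[-1/e,0)$ with values in $(-\infty,-1]$, i.e. $z=W_{-1}(y)$ is the solution $z\le -1$ of $ze^z=y$. The prunAdag algorithm. Given are a starting point $x_0\in\mathbb{R}^n$, a target number $T\in\{2,\dots,n\}$, a constant $\varsigma\in(0,1)$, and initial weights $w_{i,-1}^{\mathcal{O}}=w_{i,-1}^{\mathcal{D}}=\sqrt{\varsigma}$ for $i=1,\dots,n$. For $k=0,1,2,\dots$: 1. Compute $g_k=g(x_k)$ and let $\mathcal{R}_k=\{i\in\{1,\dots,n\}: |g_{i,k}|\text{ is one of the }T\text{ largest components of }|g_k|\}$ (a set of $T$ indices of largest components in absolute value). 2. Compute tentative weights $\widehat w_{i,k}=\sqrt{(w_{i,k-1}^{\mathcal{O}})^2+g_{i,k}^2}$ for all $i\in\{1,\dots,n\}$. 3. Choose arbitrary bounds $a_{i,k}\ge 0$, $b_{i,k}\ge0$ for $i\in\mathcal{R}_k^C$ ($b_{i,k}=+\infty$ is allowed), and let $$\mathcal{A}_k=\left\{i\in\mathcal{R}_k^C : \mathrm{sign}(x_{i,k})=\mathrm{sign}(g_{i,k})\ \text{and}\ a_{i,k}\le\left|\frac{g_{i,k}}{\widehat w_{i,k}}\right|\le b_{i,k}\right\}.$$ Set $\mathcal{O}_k=\mathcal{R}_k\cup\mathcal{A}_k$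 (optimisable indices) and $\mathcal{D}_k=\mathcal{O}_k^C$ (decreasable indices). 4. For $i\in\mathcal{O}_k$: set $w_{i,k}^{\mathcal{O}}=\widehat w_{i,k}$, $w_{i,k}^{\mathcal{D}}=w_{i,k-1}^{\mathcal{D}}$, and $s_{i,k}=-g_{i,k}/w_{i,k}^{\mathcal{O}}$. 5. For $i\in\mathcal{D}_k$: set $w_{i,k}^{\mathcal{O}}=w_{i,k-1}^{\mathcal{O}}$, $w_{i,k}^{\mathcal{D}}=\sqrt{(w_{i,k-1}^{\mathcal{D}})^2+x_{i,k}^2}$, $s_{i,k}^L=-x_{i,k}/w_{i,k}^{\mathcal{D}}$, and choose any $s_{i,k}$ ($i\in\mathcal{D}_k$) such that $|s_{i,k}|\le|s_{i,k}^L|$ for all $i\in\mathcal{D}_k$ and $\sum_{i\in\mathcal{D}_k}g_{i,k}s_{i,k}\le0$. 6. Set $x_{k+1}=x_k+s_k$. *)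

theory Defs
  imports "HOL-Analysis.Analysis"
begin

definition lambert_W_m1 :: "real \<Rightarrow> real" where
  "lambert_W_m1 y = (THE z. z \<le> -1 \<and> z * exp z = y)"

lemma lambert_W_m1_ex1:
  fixes y :: real
  assumes "- exp (-1) \<le> y" and "y < 0"
  shows "\<exists>!z. z \<le> -1 \<and> z * exp z = y"
proof -
  have deriv: "((\<lambda>z. z * exp z) has_real_derivative (1 + z) * exp z) (at z)" for z :: real
    by (auto intro!: derivative_eq_intros simp: algebra_simps)
  have anti: "v * exp v < u * exp u" if "u < v" "v \<le> -1" for u v :: real
  proof (rule DERIV_neg_imp_decreasing_open[OF that(1)])
    show "\<exists>d. ((\<lambda>z. z * exp z) has_real_derivative d) (at z) \<and> d < 0"
      if "u < z" "z < v" for z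
      using deriv[of z] that \<open>v \<le> -1\<close> by (auto simp: mult_neg_pos)
  qed (intro continuous_intros)
  have "((\<lambda>z::real. z * exp z) \<longlongrightarrow> 0) at_bot"
    using tendsto_minus[OF tendsto_power_div_exp_0[of 1]]
    by (subst at_bot_mirror) (simp add: filterlim_filtermap exp_minus field_simps)
  then have "eventually (\<lambda>z::real. y < z * exp z \<and> z \<le> -1) at_bot"
    using order_tendstoD(1)[OF _ \<open>y < 0\<close>] eventually_le_at_bot
    by (intro eventually_conj) auto
  then obtain u :: real where u: "y < u * exp u" "u \<le> -1"
    using eventually_happens by fastforce
  have "\<exists>z\<ge>u. z \<le> -1 \<and> z * exp z = y"
    using u assms(1) by (intro IVT2) (auto intro!: continuous_intros)
  then obtain z where z: "z \<le> -1" "z * exp z = y" by blast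
  show ?thesis
  proof (rule ex1I[of _ z])
    show "z' = z" if "z' \<le> -1 \<and> z' * exp z' = y" for z'
      using anti[of z z'] anti[of z' z] z that by (cases z z' rule: linorder_cases) auto
  qed (use z in auto)
qed

text \<open>Ties are broken arbitrarily: every set of \<open>T\<close> largest components is admissible.\<close>

definition relevant_set :: "nat \<Rightarrow> real ^ 'n \<Rightarrow> 'n::finite set \<Rightarrow> bool" where
  "relevant_set T g R \<longleftrightarrow> card R = T \<and> (\<forall>i\<in>R. \<forall>j\<in>-R. \<bar>g $ j\<bar> \<le> \<bar>g $ i\<bar>)"

definition tentative_weights :: "real ^ 'n \<Rightarrow> real ^ 'n \<Rightarrow> real ^ 'n::finite" where
  "tentative_weights w g = (\<chi> i. sqrt ((w $ i)\<^sup>2 + (g $ i)\<^sup>2))"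

definition added_set ::
  "real ^ 'n \<Rightarrow> real ^ 'n \<Rightarrow> real ^ 'n \<Rightarrow> 'n::finite set \<Rightarrow> ('n \<Rightarrow> real) \<Rightarrow> ('n \<Rightarrow> ereal) \<Rightarrow> 'n set"
  where
  "added_set x g w R a b =
     {i \<in> -R. sgn (x $ i) = sgn (g $ i) \<and>
              a i \<le> \<bar>g $ i / w $ i\<bar> \<and> ereal \<bar>g $ i / w $ i\<bar> \<le> b i}"

text \<open>One iteration at the point \<open>x\<close> with gradient \<open>g\<close>: \<open>wO\<close>, \<open>wD\<close> are the incoming weights,
  \<open>wO'\<close>, \<open>wD'\<close> the updated ones, and \<open>s\<close> is the step.  The free choices of the algorithm make
  this a relation rather than a function.\<close>

definition prunAdag_step ::
  "nat \<Rightarrow> real ^ 'n \<Rightarrow> real ^ 'n \<Rightarrow> real ^ 'n \<Rightarrow> real ^ 'n \<Rightarrow>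
   real ^ 'n \<Rightarrow> real ^ 'n \<Rightarrow> real ^ 'n::finite \<Rightarrow> bool" where
  "prunAdag_step T x g wO wD wO' wD' s \<longleftrightarrow>
     (\<exists>R a b.
        relevant_set T g R \<and>
        (\<forall>i\<in>-R. 0 \<le> a i \<and> 0 \<le> b i) \<and>
        (let wh = tentative_weights wO g;
             Opt = R \<union> added_set x g wh R a b;
             Dec = - Opt
         in (\<forall>i\<in>Opt. wO' $ i = wh $ i \<and> wD' $ i = wD $ i \<and> s $ i = - (g $ i) / wO' $ i) \<and>
            (\<forall>i\<in>Dec. wO' $ i = wO $ i \<and> wD' $ i = sqrt ((wD $ i)\<^sup>2 + (x $ i)\<^sup>2) \<and>
                      \<bar>s $ i\<bar> \<le> \<bar>- (x $ i) / wD' $ i\<bar>) \<and>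
            (\<Sum>i\<in>Dec. g $ i * s $ i) \<le> 0))"

text \<open>The weight sequences are shifted by one: \<open>wO k\<close> and \<open>wD k\<close> are the weights of
  iteration \<open>k - 1\<close>, so \<open>wO 0\<close> and \<open>wD 0\<close> are the initial weights.\<close>

definition prunAdag_iterates ::
  "(real ^ 'n \<Rightarrow> real ^ 'n) \<Rightarrow> nat \<Rightarrow> real \<Rightarrow> (nat \<Rightarrow> real ^ 'n::finite) \<Rightarrow> bool" where
  "prunAdag_iterates g T \<sigma> x \<longleftrightarrow>
     (\<exists>wO wD s.
        (\<forall>i. wO 0 $ i = sqrt \<sigma> \<and> wD 0 $ i = sqrt \<sigma>) \<and>
        (\<forall>k. prunAdag_step T (x k) (g (x k)) (wO k) (wD k) (wO (Suc k)) (wD (Suc k)) (s k) \<and>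
             x (Suc k) = x k + s k))"

definition theta :: "nat \<Rightarrow> real \<Rightarrow> real \<Rightarrow> real \<Rightarrow> real \<Rightarrow> nat \<Rightarrow> real" where
  "theta n L \<sigma> \<Gamma>0 \<kappa> k =
     Max {\<sigma>,
          \<sigma> / 2 * exp (\<Gamma>0 / (real n * L)),
          32 * (real n)\<^sup>2 * L\<^sup>2 * \<bar>lambert_W_m1 (- sqrt \<sigma> / (8 * real n * L))\<bar>\<^sup>2,
          2 * (\<Gamma>0 + real n * L * ln (1 + (real k + 1) * \<kappa>\<^sup>2 / \<sigma>))\<^sup>2}"

end

theory Submission
  imports Defs
begin

text \<open>The descent lemma, summed over the iterations, bounds \<open>S / sqrt (\<sigma> + S)\<close>, where \<open>S\<close> is the
  sum of all squared gradient components at optimisable indices, by \<open>\<Gamma>\<^sub>0\<close> plus \<open>L / 2\<close> times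
  the sums of the squared Adagrad-type steps.  For each index these are sums of
  \<open>c\<^sub>j / (\<sigma> + c\<^sub>0 + \<dots> + c\<^sub>j)\<close> and hence grow only logarithmically.  The resulting inequality between
  \<open>sqrt S\<close> and \<open>ln S\<close> confines \<open>S\<close> below \<open>\<theta>(k)\<close>, the Lambert term being the larger root
  of the corresponding equation.  Finally, the \<open>T\<close> largest squared components carry at least the
  fraction \<open>T / n\<close> of the squared norm of the gradient.\<close>

section \<open>Smoothness, logarithmic sums and the scalar inequality behind
  \<open>theta\<close>\<close>

text \<open>Subtracting the quadratic model from \<open>f\<close> along the segment leaves a
  function with derivative \<open>inner (g (x + t *\<^sub>R s) - g x) s - L * t * (norm
  s)\<^sup>2\<close>. Cauchy-Schwarz and the Lipschitz bound make it nonpositive; comparing the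
  endpoints gives the claim.\<close>

lemma descent_lemma:
  fixes f :: "'a::real_inner \<Rightarrow> real"
  assumes gradient: "\<And>y. GDERIV f y :> g y" and lipschitz: "L-lipschitz_on UNIV g"
  shows "f (x + s) \<le> f x + inner (g x) s + L / 2 * (norm s)\<^sup>2"
proof -
  define \<phi> where "\<phi> t = f (x + t *\<^sub>R s) - t * inner (g x) s - L / 2 * t\<^sup>2 * (norm s)\<^sup>2" for t
  have "\<phi> 1 \<le> \<phi> 0"
  proof (rule DERIV_nonpos_imp_nonincreasing[of 0 1 \<phi>])
    fix t :: real
    assume t: "0 \<le> t" "t \<le> 1"
    have "(f has_derivative (\<lambda>h. inner h (g (x + t *\<^sub>R s)))) (at (x + t *\<^sub>R s))"
      using gradient unfolding gderiv_def .
    moreover have "((\<lambda>t. x + t *\<^sub>R s) has_derivative (\<lambda>h. h *\<^sub>R s)) (at t)"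
      by (auto intro!: derivative_eq_intros)
    ultimately have "((\<lambda>t. f (x + t *\<^sub>R s)) has_derivative (\<lambda>h. inner (h *\<^sub>R s) (g (x + t *\<^sub>R s)))) (at t)"
      using has_derivative_compose by fastforce
    then have "((\<lambda>t. f (x + t *\<^sub>R s)) has_real_derivative inner (g (x + t *\<^sub>R s)) s) (at t)"
      unfolding has_field_derivative_def
      by (rule has_derivative_eq_rhs) (auto simp: inner_commute)
    then have "(\<phi> has_real_derivative
        inner (g (x + t *\<^sub>R s)) s - inner (g x) s - L * t * (norm s)\<^sup>2) (at t)"
      unfolding \<phi>_def by (auto intro!: derivative_eq_intros)
    moreover have "inner (g (x + t *\<^sub>R s)) s - inner (g x) s \<le> L * t * (norm s)\<^sup>2"
    proof -
      have "inner (g (x + t *\<^sub>R s) - g x) s \<le> norm (g (x + t *\<^sub>R s) - g x) * norm s"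
        by (rule norm_cauchy_schwarz)
      also have "norm (g (x + t *\<^sub>R s) - g x) \<le> L * norm (t *\<^sub>R s)"
        using lipschitz_onD[OF lipschitz, of "x + t *\<^sub>R s" x] by (simp add: dist_norm)
      finally show ?thesis
        using t by (simp add: inner_diff_left power2_eq_square mult_right_mono)
    qed
    ultimately show "\<exists>y. (\<phi> has_real_derivative y) (at t) \<and> y \<le> 0"
      by (intro exI conjI) auto
  qed simp
  then show ?thesis by (simp add: \<phi>_def)
qed

text \<open>If \<open>A\<close> and \<open>B\<close> are consecutive denominators, then
  \<open>ln t \<le> t - 1\<close> at \<open>t = A / B\<close> bounds the term \<open>c m / B\<close>
  by \<open>ln B - ln A\<close>, which telescopes. The denominator must include the current term, as
  the updated weights do.\<close>

lemma sum_div_partial_sums_le_ln: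
  fixes c :: "nat \<Rightarrow> real"
  assumes "0 < \<sigma>" and c: "\<And>j. 0 \<le> c j"
  shows "(\<Sum>j<m. c j / (\<sigma> + (\<Sum>l<Suc j. c l))) \<le> ln (1 + (\<Sum>j<m. c j) / \<sigma>)"
proof -
  have pos: "0 < \<sigma> + (\<Sum>l<m. c l)" for m
    using assms by (simp add: add_pos_nonneg sum_nonneg)
  have "(\<Sum>j<m. c j / (\<sigma> + (\<Sum>l<Suc j. c l))) \<le> ln (\<sigma> + (\<Sum>j<m. c j)) - ln \<sigma>"
  proof (induction m)
    case (Suc m)
    define A B where "A = \<sigma> + (\<Sum>l<m. c l)" and "B = \<sigma> + (\<Sum>l<Suc m. c l)"
    have "0 < A" "0 < B" "A = B - c m"
      using pos[of m] pos[of "Suc m"] by (auto simp: A_def B_def)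
    then have "ln A - ln B \<le> A / B - 1"
      using ln_le_minus_one[of "A / B"] by (simp add: ln_div)
    also have "\<dots> = - (c m / B)"
      using \<open>0 < B\<close> unfolding \<open>A = B - c m\<close> by (simp add: diff_divide_distrib)
    finally show ?case
      using Suc by (simp add: A_def B_def)
  qed simp
  also have "\<dots> = ln (1 + (\<Sum>j<m. c j) / \<sigma>)"
  proof -
    have "1 + (\<Sum>j<m. c j) / \<sigma> = (\<sigma> + (\<Sum>j<m. c j)) / \<sigma>"
      using \<open>0 < \<sigma>\<close> by (simp add: field_simps)
    then show ?thesis
      using pos[of m] \<open>0 < \<sigma>\<close> by (simp add: ln_div)
  qed
  finally show ?thesis .
qed

text \<open>With \<open>z\<close> the Lambert value at \<open>- c\<close>, the point
  \<open>v = exp (- z)\<close> solves \<open>ln v = c * v\<close>, and the hypothesis on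
  \<open>u\<close> says \<open>v \<le> u\<close>. From \<open>v\<close> on, \<open>ln\<close> has
  slope at most \<open>1 / v\<close>, which is at most \<open>c\<close> because
  \<open>c * v = - z \<ge> 1\<close>, so the line stays above it.\<close>

lemma ln_le_mult_of_lambert_le:
  fixes c u :: real
  assumes c: "0 < c" "c \<le> exp (-1)" and u: "\<bar>lambert_W_m1 (- c)\<bar> / c \<le> u"
  shows "ln u \<le> c * u"
proof -
  define z where "z = lambert_W_m1 (- c)"
  have z: "z \<le> -1" "z * exp z = - c"
    using theI'[OF lambert_W_m1_ex1[of "- c"]] c unfolding z_def lambert_W_m1_def by auto
  define v where "v = exp (- z)"
  have "0 < v" and cv: "c * v = - z"
    using z by (simp_all add: v_def exp_minus field_simps)
  then have "v \<le> u"
    using u z c by (metis abs_of_nonpos cv nonzero_mult_div_cancel_left order.strict_iff_not order.trans neg_le_0_iff_le zero_le_one z_def)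
  then have "ln (u / v) \<le> u / v - 1"
    using \<open>0 < v\<close> by (intro ln_le_minus_one) simp
  \<comment> \<open>Here \<open>- z \<ge> 1\<close> enters: enlarging the nonnegative gap
    \<open>u / v - 1\<close> by this factor turns the tangent bound into one with slope
    \<open>c\<close>.\<close>
  also have "\<dots> \<le> - z * (u / v - 1)"
    using mult_right_mono[of 1 "- z" "u / v - 1"] z \<open>v \<le> u\<close> \<open>0 < v\<close> by simp
  also have "\<dots> = c * v * (u / v - 1)"
    by (simp only: cv)
  also have "\<dots> = c * u + z"
    using \<open>0 < v\<close> minus_minus[of z, folded cv] by (simp add: right_diff_distrib)
  finally show ?thesis
    using \<open>0 < v\<close> \<open>v \<le> u\<close> by (simp add: ln_div v_def)
qed

text \<open>Each entry of the maximum has one task if \<open>S\<close> exceeds them all. The first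
  merges \<open>\<sigma> + S\<close> into \<open>2 * S\<close>, the second absorbs
  \<open>\<Gamma>\<close>, the fourth absorbs the \<open>\<kappa>\<close> logarithm. What remains is
  \<open>c * u < ln u\<close>, which the Lambert entry refutes.\<close>

lemma le_theta:
  assumes "0 < n" "0 < L" and \<sigma>: "0 < \<sigma>" "\<sigma> \<le> (8 * real n * L / 3)\<^sup>2"
    and S: "S / sqrt (\<sigma> + S) \<le> \<Gamma> + real n * L / 2 * ln (1 + S / \<sigma>)
                             + real n * L / 2 * ln (1 + (real k + 1) * \<kappa>\<^sup>2 / \<sigma>)"
  shows "S \<le> theta n L \<sigma> \<Gamma> \<kappa> k"
proof (rule ccontr)
  define N where "N = real n * L"
  define M where "M = ln (1 + (real k + 1) * \<kappa>\<^sup>2 / \<sigma>)"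
  define c where "c = sqrt \<sigma> / (8 * N)"
  \<comment> \<open>This choice makes \<open>sqrt (S / 2)\<close> linear in \<open>u\<close> and
    \<open>ln (2 * S / \<sigma>)\<close> equal to \<open>2 * ln u\<close>.\<close>
  define u where "u = sqrt (2 * S / \<sigma>)"
  assume "\<not> S \<le> theta n L \<sigma> \<Gamma> \<kappa> k"
  then have "\<sigma> < S" and S_exp: "\<sigma> / 2 * exp (\<Gamma> / N) < S"
    and S_lambert: "32 * N\<^sup>2 * \<bar>lambert_W_m1 (- c)\<bar>\<^sup>2 < S"
    and S_ln: "2 * (\<Gamma> + N * M)\<^sup>2 < S"
    unfolding theta_def N_def M_def c_def
    by (simp_all add: not_le power_mult_distrib mult.assoc)
  have "0 < N" using assms by (simp add: N_def)
  have "0 < S" using \<open>\<sigma> < S\<close> \<open>0 < \<sigma>\<close> by simp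
  have "0 < u" "1 < u" using \<open>0 < S\<close> \<open>\<sigma> < S\<close> \<sigma> by (simp_all add: u_def)
  have ln_u: "ln (2 * S / \<sigma>) = 2 * ln u"
    using \<open>0 < S\<close> \<sigma> by (simp add: u_def ln_sqrt)
  have half: "sqrt (S / 2) = sqrt \<sigma> * u / 2"
    using \<open>0 < S\<close> \<sigma> by (simp add: u_def real_sqrt_mult real_sqrt_divide field_simps)
  have "sqrt (S / 2) = S / sqrt (2 * S)"
    using \<open>0 < S\<close> by (simp add: real_sqrt_divide real_sqrt_mult field_simps)
  also have "\<dots> \<le> S / sqrt (\<sigma> + S)"
    using \<open>\<sigma> < S\<close> \<open>0 < S\<close> \<sigma> by (intro divide_left_mono) auto
  also have "\<dots> \<le> \<Gamma> + N / 2 * ln (1 + S / \<sigma>) + N / 2 * M"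
    using S by (simp add: N_def M_def)
  also have "ln (1 + S / \<sigma>) \<le> 2 * ln u"
    unfolding ln_u[symmetric] using \<open>\<sigma> < S\<close> \<sigma> by (subst ln_le_cancel_iff) (auto simp: field_simps add_pos_pos)
  finally have main: "sqrt (S / 2) \<le> \<Gamma> + N * ln u + N / 2 * M"
    using \<open>0 < N\<close> by simp
  have "\<Gamma> + N * M < sqrt (S / 2)"
    using S_ln by (intro real_less_rsqrt) simp
  with main have "N * M < N * (2 * ln u)" by simp
  moreover have "\<Gamma> < N * (2 * ln u)"
  proof -
    have "exp (\<Gamma> / N) < 2 * S / \<sigma>"
      using S_exp \<sigma> by (simp add: field_simps)
    then have "\<Gamma> / N < ln (2 * S / \<sigma>)"
      using \<open>0 < S\<close> \<sigma> by (metis exp_less_cancel_iff exp_ln divide_pos_pos mult_pos_pos zero_less_numeral)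
    then show ?thesis
      using \<open>0 < N\<close> unfolding ln_u by (simp add: field_simps)
  qed
  \<comment> \<open>In \<open>main\<close>, \<open>\<Gamma>\<close> costs at most two units of
    \<open>N * ln u\<close>, and the two logarithmic terms one unit each; this is the origin of the
    4, and of the 8 in \<open>c\<close>.\<close>
  ultimately have "sqrt \<sigma> * u / 2 < 4 * N * ln u"
    using main half by (simp add: mult.assoc)
  then have "c * u < ln u"
    using \<open>0 < N\<close> by (simp add: c_def field_simps)
  moreover have "ln u \<le> c * u"
  proof (rule ln_le_mult_of_lambert_le)
    show "0 < c" using \<sigma> \<open>0 < N\<close> by (simp add: c_def)
    \<comment> \<open>The upper bound on \<open>\<sigma>\<close> serves to put \<open>- c\<close> in
      the domain of the Lambert branch; the 3 is the upper bound on \<open>exp 1\<close>.\<close>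
    have "sqrt \<sigma> \<le> 8 * N / 3"
      using \<sigma> \<open>0 < N\<close> by (intro real_le_lsqrt) (auto simp: N_def mult.assoc)
    then have "c \<le> 1 / 3"
      using \<open>0 < N\<close> by (simp add: c_def field_simps)
    also have "\<dots> \<le> exp (-1)"
      using exp_le by (simp add: exp_minus field_simps)
    finally show "c \<le> exp (-1)" .
    \<comment> \<open>Squaring the comparison with \<open>u\<close> turns it into \<open>64 *
      N\<^sup>2 * \<bar>lambert_W_m1 (- c)\<bar>\<^sup>2 \<le> 2 * S\<close>, hence the constant 32
      in \<open>theta\<close>.\<close>
    have "\<bar>lambert_W_m1 (- c)\<bar> / c = 8 * N * \<bar>lambert_W_m1 (- c)\<bar> / sqrt \<sigma>"
      using \<sigma> \<open>0 < N\<close> by (simp add: c_def)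
    also have "\<dots> \<le> u"
      unfolding u_def using S_lambert \<sigma>
      by (intro real_le_rsqrt) (simp add: power_divide power_mult_distrib field_simps)
    finally show "\<bar>lambert_W_m1 (- c)\<bar> / c \<le> u" .
  qed
  ultimately show False by simp
qed

section \<open>The share of the gradient carried by the relevant components\<close>

text \<open>Sum the pairwise inequality over all pairs; on each side the index that does not occur
  contributes a cardinality.\<close>

lemma card_mult_sum_le_of_dominated:
  fixes h :: "'a \<Rightarrow> real"
  assumes "\<And>i j. i \<in> A \<Longrightarrow> j \<in> B \<Longrightarrow> h j \<le> h i"
  shows "real (card A) * sum h B \<le> real (card B) * sum h A"
proof -
  have "real (card A) * sum h B = (\<Sum>i\<in>A. \<Sum>j\<in>B. h j)" by simp
  also have "\<dots> \<le> (\<Sum>i\<in>A. \<Sum>j\<in>B. h i)"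
    using assms by (intro sum_mono)
  also have "\<dots> = real (card B) * sum h A"
    by (simp add: sum_distrib_left)
  finally show ?thesis .
qed

lemma sum_UNIV_eq_sum_plus_sum_Compl:
  fixes h :: "'a::finite \<Rightarrow> 'b::comm_monoid_add"
  shows "sum h UNIV = sum h A + sum h (- A)"
  using sum.union_disjoint[of A "- A" h] by simp

lemma norm_sq_vec: "(norm (v :: real ^ 'n::finite))\<^sup>2 = (\<Sum>i\<in>UNIV. (v $ i)\<^sup>2)"
  by (simp add: norm_vec_def L2_set_def sum_nonneg)

text \<open>Domination bounds \<open>T\<close> times the sum outside \<open>R\<close> by
  \<open>card (- R)\<close> times the sum over \<open>R\<close>. Adding \<open>T\<close> times the
  latter sum to both sides completes the norm on the left and the factor \<open>CARD('n)\<close> on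
  the right.\<close>

lemma relevant_set_norm_sq_le:
  fixes v :: "real ^ 'n::finite"
  assumes "relevant_set T v R"
  shows "real T * (norm v)\<^sup>2 \<le> real CARD('n) * (\<Sum>i\<in>R. (v $ i)\<^sup>2)"
proof -
  let ?h = "\<lambda>i. (v $ i)\<^sup>2"
  have T: "card R = T" and dom: "\<And>i j. i \<in> R \<Longrightarrow> j \<in> - R \<Longrightarrow> ?h j \<le> ?h i"
    using assms by (auto simp: relevant_set_def abs_le_square_iff)
  have "real T * sum ?h (- R) \<le> real (card (- R)) * sum ?h R"
    using card_mult_sum_le_of_dominated[of R "- R" ?h, OF dom] T by simp
  moreover have "sum ?h UNIV = sum ?h R + sum ?h (- R)"
    by (rule sum_UNIV_eq_sum_plus_sum_Compl)
  moreover have "CARD('n) = T + card (- R)"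
    using T sum_UNIV_eq_sum_plus_sum_Compl[of "\<lambda>_. 1 :: nat" R] by simp
  ultimately show ?thesis
    by (simp add: norm_sq_vec algebra_simps)
qed

section \<open>What one iteration guarantees\<close>

text \<open>Reduces an iteration to one index set \<open>Opt\<close> and the estimates used later,
  hiding \<open>R\<close> and the bounds behind \<open>added_set\<close>. The conditional increments
  give both weight updates a form valid at every index, with zero increment where a weight is
  kept.\<close>

lemma prunAdag_stepE:
  fixes x g wO wD wO' wD' s :: "real ^ 'n::finite"
  assumes "prunAdag_step T x g wO wD wO' wD' s"
  obtains Opt where
    "real T * (norm g)\<^sup>2 \<le> real CARD('n) * (\<Sum>i\<in>Opt. (g $ i)\<^sup>2)"
    "\<And>i. (wO' $ i)\<^sup>2 = (wO $ i)\<^sup>2 + (if i \<in> Opt then (g $ i)\<^sup>2 else 0)"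
    "\<And>i. (wD' $ i)\<^sup>2 = (wD $ i)\<^sup>2 + (if i \<in> Opt then 0 else (x $ i)\<^sup>2)"
    "\<And>i. i \<in> Opt \<Longrightarrow> wO' $ i \<ge> 0"
    "inner g s \<le> - (\<Sum>i\<in>Opt. (g $ i)\<^sup>2 / wO' $ i)"
    "(norm s)\<^sup>2 \<le> (\<Sum>i\<in>UNIV. (if i \<in> Opt then (g $ i)\<^sup>2 else 0) / (wO' $ i)\<^sup>2
                         + (if i \<in> Opt then 0 else (x $ i)\<^sup>2) / (wD' $ i)\<^sup>2)"
proof -
  obtain R Opt where R: "relevant_set T g R" and "R \<subseteq> Opt"
    and O: "\<And>i. i \<in> Opt \<Longrightarrow> wO' $ i = sqrt ((wO $ i)\<^sup>2 + (g $ i)\<^sup>2) \<and> wD' $ i = wD $ i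
                           \<and> s $ i = - (g $ i) / wO' $ i"
    and D: "\<And>i. i \<notin> Opt \<Longrightarrow> wO' $ i = wO $ i \<and> wD' $ i = sqrt ((wD $ i)\<^sup>2 + (x $ i)\<^sup>2)
                           \<and> \<bar>s $ i\<bar> \<le> \<bar>- (x $ i) / wD' $ i\<bar>"
    and D_sum: "(\<Sum>i\<in>- Opt. g $ i * s $ i) \<le> 0"
  proof -
    from assms obtain R a b where *: "relevant_set T g R"
      "let wh = tentative_weights wO g; Opt = R \<union> added_set x g wh R a b; Dec = - Opt
       in (\<forall>i\<in>Opt. wO' $ i = wh $ i \<and> wD' $ i = wD $ i \<and> s $ i = - (g $ i) / wO' $ i) \<and>
          (\<forall>i\<in>Dec. wO' $ i = wO $ i \<and> wD' $ i = sqrt ((wD $ i)\<^sup>2 + (x $ i)\<^sup>2) \<and>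
                    \<bar>s $ i\<bar> \<le> \<bar>- (x $ i) / wD' $ i\<bar>) \<and>
          (\<Sum>i\<in>Dec. g $ i * s $ i) \<le> 0"
      unfolding prunAdag_step_def by (elim exE conjE) (rule that)
    define Opt where "Opt = R \<union> added_set x g (tentative_weights wO g) R a b"
    have O: "\<forall>i\<in>Opt. wO' $ i = tentative_weights wO g $ i \<and> wD' $ i = wD $ i
                \<and> s $ i = - (g $ i) / wO' $ i"
      and D: "\<forall>i\<in>- Opt. wO' $ i = wO $ i \<and> wD' $ i = sqrt ((wD $ i)\<^sup>2 + (x $ i)\<^sup>2)
                \<and> \<bar>s $ i\<bar> \<le> \<bar>- (x $ i) / wD' $ i\<bar>"
      and D_sum: "(\<Sum>i\<in>- Opt. g $ i * s $ i) \<le> 0"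
      using *(2)[unfolded Let_def, folded Opt_def] by - (elim conjE, assumption)+
    show thesis
    proof (rule that[OF *(1) _ _ _ D_sum])
      show "R \<subseteq> Opt"
        by (simp add: Opt_def)
      show "wO' $ i = sqrt ((wO $ i)\<^sup>2 + (g $ i)\<^sup>2) \<and> wD' $ i = wD $ i
          \<and> s $ i = - (g $ i) / wO' $ i" if "i \<in> Opt" for i
        using bspec[OF O that] by (simp only: tentative_weights_def vec_lambda_beta)
      show "wO' $ i = wO $ i \<and> wD' $ i = sqrt ((wD $ i)\<^sup>2 + (x $ i)\<^sup>2)
          \<and> \<bar>s $ i\<bar> \<le> \<bar>- (x $ i) / wD' $ i\<bar>" if "i \<notin> Opt" for i
        using that by (intro bspec[OF D]) simp
    qed
  qed
  show thesis
  proof (rule that[of Opt])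
    have "real T * (norm g)\<^sup>2 \<le> real CARD('n) * (\<Sum>i\<in>R. (g $ i)\<^sup>2)"
      by (rule relevant_set_norm_sq_le[OF R])
    also have "\<dots> \<le> real CARD('n) * (\<Sum>i\<in>Opt. (g $ i)\<^sup>2)"
      using \<open>R \<subseteq> Opt\<close> by (intro mult_left_mono sum_mono2) auto
    finally show "real T * (norm g)\<^sup>2 \<le> \<dots>" .
    show "(wO' $ i)\<^sup>2 = (wO $ i)\<^sup>2 + (if i \<in> Opt then (g $ i)\<^sup>2 else 0)" for i
      using O[of i] D[of i] by auto
    show "(wD' $ i)\<^sup>2 = (wD $ i)\<^sup>2 + (if i \<in> Opt then 0 else (x $ i)\<^sup>2)" for i
      using O[of i] D[of i] by auto
    show "wO' $ i \<ge> 0" if "i \<in> Opt" for i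
      using O[OF that] by simp
    have "inner g s = (\<Sum>i\<in>Opt. g $ i * s $ i) + (\<Sum>i\<in>- Opt. g $ i * s $ i)"
      unfolding inner_vec_def inner_real_def
      by (rule sum_UNIV_eq_sum_plus_sum_Compl)
    also have "(\<Sum>i\<in>Opt. g $ i * s $ i) = - (\<Sum>i\<in>Opt. (g $ i)\<^sup>2 / wO' $ i)"
      unfolding sum_negf[symmetric] using O by (intro sum.cong) (simp_all add: power2_eq_square)
    finally show "inner g s \<le> - (\<Sum>i\<in>Opt. (g $ i)\<^sup>2 / wO' $ i)"
      using D_sum by simp
    \<comment> \<open>Exactly one summand has its numerator switched on. At an optimisable index the
      bound is an equality; elsewhere it is the cap on the step.\<close>
    have "(s $ i)\<^sup>2 \<le> (if i \<in> Opt then (g $ i)\<^sup>2 else 0) / (wO' $ i)\<^sup>2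
                    + (if i \<in> Opt then 0 else (x $ i)\<^sup>2) / (wD' $ i)\<^sup>2" for i
    proof (cases "i \<in> Opt")
      case True
      then show ?thesis using O[of i] by (simp add: power_divide)
    next
      case False
      then have "(s $ i)\<^sup>2 \<le> (- (x $ i) / wD' $ i)\<^sup>2"
        using D[of i] abs_le_square_iff by blast
      with False show ?thesis by (simp add: power_divide)
    qed
    then show "(norm s)\<^sup>2 \<le> (\<Sum>i\<in>UNIV. (if i \<in> Opt then (g $ i)\<^sup>2 else 0) / (wO' $ i)\<^sup>2
                         + (if i \<in> Opt then 0 else (x $ i)\<^sup>2) / (wD' $ i)\<^sup>2)"
      unfolding norm_sq_vec by (rule sum_mono)
  qed
qed

section \<open>Summation of the descent over the iterations\<close>

lemma prunAdag_descent:
  fixes f :: "real ^ 'n::finite \<Rightarrow> real" and x :: "nat \<Rightarrow> real ^ 'n"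
  assumes gradient: "\<And>y. GDERIV f y :> g y" and lipschitz: "L-lipschitz_on UNIV g"
    and "0 < \<sigma>" and iterates: "prunAdag_iterates g T \<sigma> x"
    and \<kappa>: "\<And>i j. \<bar>x j $ i\<bar> \<le> \<kappa>"
  obtains S where "real T * (\<Sum>j<m. (norm (g (x j)))\<^sup>2) \<le> real CARD('n) * S" and "0 \<le> S"
    and "S / sqrt (\<sigma> + S) \<le> f (x 0) - f (x m) + real CARD('n) * L / 2 * ln (1 + S / \<sigma>)
                             + real CARD('n) * L / 2 * ln (1 + real m * \<kappa>\<^sup>2 / \<sigma>)"
proof -
  from iterates obtain wO wD s where
    init: "\<And>i. wO 0 $ i = sqrt \<sigma>" "\<And>i. wD 0 $ i = sqrt \<sigma>"
    and step: "\<And>k. prunAdag_step T (x k) (g (x k)) (wO k) (wD k) (wO (Suc k)) (wD (Suc k)) (s k)"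
    and next_iterate: "\<And>k. x (Suc k) = x k + s k"
    unfolding prunAdag_iterates_def by blast
  \<comment> \<open>Collecting the six estimates in one predicate allows \<open>Opt j\<close> to be
    chosen for all iterations at once.\<close>
  define is_opt where "is_opt j Opt \<longleftrightarrow>
    real T * (norm (g (x j)))\<^sup>2 \<le> real CARD('n) * (\<Sum>i\<in>Opt. (g (x j) $ i)\<^sup>2) \<and>
    (\<forall>i. (wO (Suc j) $ i)\<^sup>2 = (wO j $ i)\<^sup>2 + (if i \<in> Opt then (g (x j) $ i)\<^sup>2 else 0)) \<and>
    (\<forall>i. (wD (Suc j) $ i)\<^sup>2 = (wD j $ i)\<^sup>2 + (if i \<in> Opt then 0 else (x j $ i)\<^sup>2)) \<and>
    (\<forall>i\<in>Opt. wO (Suc j) $ i \<ge> 0) \<and>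
    inner (g (x j)) (s j) \<le> - (\<Sum>i\<in>Opt. (g (x j) $ i)\<^sup>2 / wO (Suc j) $ i) \<and>
    (norm (s j))\<^sup>2 \<le> (\<Sum>i\<in>UNIV. (if i \<in> Opt then (g (x j) $ i)\<^sup>2 else 0) / (wO (Suc j) $ i)\<^sup>2
                         + (if i \<in> Opt then 0 else (x j $ i)\<^sup>2) / (wD (Suc j) $ i)\<^sup>2)" for j Opt
  have "\<exists>Opt. is_opt j Opt" for j
    unfolding is_opt_def
    by (rule prunAdag_stepE[OF step[of j]], rule exI, intro conjI, assumption) blast+
  then obtain Opt where Opt: "\<And>j. is_opt j (Opt j)" by metis
  define G where "G j i = (if i \<in> Opt j then (g (x j) $ i)\<^sup>2 else 0)" for j i
  define X where "X j i = (if i \<in> Opt j then 0 else (x j $ i)\<^sup>2)" for j i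
  have nonneg: "0 \<le> G j i" "0 \<le> X j i" for j i
    by (simp_all add: G_def X_def)
  have sum_G: "(\<Sum>i\<in>UNIV. G j i) = (\<Sum>i\<in>Opt j. (g (x j) $ i)\<^sup>2)" for j
    unfolding G_def by (simp add: sum.If_cases)
  have "(wO (Suc j) $ i)\<^sup>2 = (wO j $ i)\<^sup>2 + G j i" for i j
    using Opt[of j] unfolding is_opt_def G_def by blast
  \<comment> \<open>Index \<open>j\<close> denotes the weights entering iteration \<open>j\<close>,
    so the sum stops before \<open>j\<close>; the weights that divide the step are those at
    \<open>Suc j\<close> and include the current term.\<close>
  then have wO: "(wO j $ i)\<^sup>2 = \<sigma> + (\<Sum>l<j. G l i)" for i j
    using \<open>0 < \<sigma>\<close> by (induct j) (simp_all add: init)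
  have "(wD (Suc j) $ i)\<^sup>2 = (wD j $ i)\<^sup>2 + X j i" for i j
    using Opt[of j] unfolding is_opt_def X_def by blast
  then have wD: "(wD j $ i)\<^sup>2 = \<sigma> + (\<Sum>l<j. X l i)" for i j
    using \<open>0 < \<sigma>\<close> by (induct j) (simp_all add: init)
  define S where "S = (\<Sum>j<m. \<Sum>i\<in>UNIV. G j i)"
  have "0 \<le> S" unfolding S_def by (intro sum_nonneg nonneg)
  have "0 \<le> L" using lipschitz by (rule lipschitz_on_nonneg)
  have G_le: "(\<Sum>l<m. G l i) \<le> S" for i
    unfolding S_def by (intro sum_mono member_le_sum) (auto simp: nonneg)
  have X_le: "(\<Sum>l<m. X l i) \<le> real m * \<kappa>\<^sup>2" for i
  proof -
    have "X l i \<le> \<kappa>\<^sup>2" for l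
      using abs_le_square_iff[of "x l $ i" \<kappa>] \<kappa>[of l i] by (auto simp: X_def)
    then show ?thesis
      using sum_bounded_above[of "{..<m}" "\<lambda>l. X l i" "\<kappa>\<^sup>2"] by simp
  qed

  \<comment> \<open>No optimisable weight used in the first \<open>m\<close> iterations exceeds
    \<open>sqrt (\<sigma> + S)\<close>. This common denominator lets the first-order decreases add
    up to \<open>S / sqrt (\<sigma> + S)\<close>.\<close>
  have first_order: "inner (g (x j)) (s j) \<le> - ((\<Sum>i\<in>UNIV. G j i) / sqrt (\<sigma> + S))" if "j < m" for j
  proof -
    have "(\<Sum>i\<in>UNIV. G j i) / sqrt (\<sigma> + S) = (\<Sum>i\<in>Opt j. (g (x j) $ i)\<^sup>2 / sqrt (\<sigma> + S))"
      unfolding sum_G by (rule sum_divide_distrib)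
    also have "\<dots> \<le> (\<Sum>i\<in>Opt j. (g (x j) $ i)\<^sup>2 / wO (Suc j) $ i)"
    proof (intro sum_mono divide_left_mono)
      fix i assume i: "i \<in> Opt j"
      have "(\<Sum>l<Suc j. G l i) \<le> S"
        using sum_mono2[of "{..<m}" "{..<Suc j}" "\<lambda>l. G l i"] that G_le[of i] nonneg by fastforce
      moreover have "0 \<le> (\<Sum>l<Suc j. G l i)"
        by (intro sum_nonneg nonneg)
      \<comment> \<open>The squares alone leave the sign open; nonnegativity on \<open>Opt j\<close>
        selects the root.\<close>
      moreover have "wO (Suc j) $ i = sqrt (\<sigma> + (\<Sum>l<Suc j. G l i))"
        using Opt[of j] i wO[of "Suc j" i] unfolding is_opt_def
        by (metis real_sqrt_unique)
      ultimately show "wO (Suc j) $ i \<le> sqrt (\<sigma> + S)" "0 < sqrt (\<sigma> + S) * wO (Suc j) $ i"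
        using \<open>0 < \<sigma>\<close> by auto
    qed auto
    finally show ?thesis
      using Opt[of j] unfolding is_opt_def by linarith
  qed

  have "(\<Sum>j<m. (norm (s j))\<^sup>2)
      \<le> (\<Sum>j<m. \<Sum>i\<in>UNIV. G j i / (wO (Suc j) $ i)\<^sup>2 + X j i / (wD (Suc j) $ i)\<^sup>2)"
    using Opt unfolding is_opt_def G_def X_def by (intro sum_mono) blast
  \<comment> \<open>Exchanging the sums leaves, for each index, two series of the form handled by
    \<open>sum_div_partial_sums_le_ln\<close>.\<close>
  also have "\<dots> = (\<Sum>i\<in>UNIV. (\<Sum>j<m. G j i / (\<sigma> + (\<Sum>l<Suc j. G l i)))
                           + (\<Sum>j<m. X j i / (\<sigma> + (\<Sum>l<Suc j. X l i))))"
    unfolding wO wD by (subst sum.swap) (simp only: sum.distrib)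
  also have "\<dots> \<le> (\<Sum>i\<in>(UNIV :: 'n set). ln (1 + S / \<sigma>) + ln (1 + real m * \<kappa>\<^sup>2 / \<sigma>))"
  proof (intro sum_mono add_mono)
    fix i
    have "(\<Sum>j<m. G j i / (\<sigma> + (\<Sum>l<Suc j. G l i))) \<le> ln (1 + (\<Sum>j<m. G j i) / \<sigma>)"
      by (intro sum_div_partial_sums_le_ln \<open>0 < \<sigma>\<close> nonneg)
    also have "\<dots> \<le> ln (1 + S / \<sigma>)"
      using G_le[of i] \<open>0 < \<sigma>\<close>
      by (intro ln_mono add_left_mono divide_right_mono add_pos_nonneg divide_nonneg_pos
          sum_nonneg nonneg) auto
    finally show "(\<Sum>j<m. G j i / (\<sigma> + (\<Sum>l<Suc j. G l i))) \<le> ln (1 + S / \<sigma>)" .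
    have "(\<Sum>j<m. X j i / (\<sigma> + (\<Sum>l<Suc j. X l i))) \<le> ln (1 + (\<Sum>j<m. X j i) / \<sigma>)"
      by (intro sum_div_partial_sums_le_ln \<open>0 < \<sigma>\<close> nonneg)
    also have "\<dots> \<le> ln (1 + real m * \<kappa>\<^sup>2 / \<sigma>)"
      using X_le[of i] \<open>0 < \<sigma>\<close>
      by (intro ln_mono add_left_mono divide_right_mono add_pos_nonneg divide_nonneg_pos
          sum_nonneg nonneg) auto
    finally show "(\<Sum>j<m. X j i / (\<sigma> + (\<Sum>l<Suc j. X l i))) \<le> ln (1 + real m * \<kappa>\<^sup>2 / \<sigma>)" .
  qed
  finally have second_order: "(\<Sum>j<m. (norm (s j))\<^sup>2)
      \<le> real CARD('n) * (ln (1 + S / \<sigma>) + ln (1 + real m * \<kappa>\<^sup>2 / \<sigma>))"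
    by simp

  have "f (x m) - f (x 0) = (\<Sum>j<m. f (x (Suc j)) - f (x j))"
    by (rule sum_lessThan_telescope[symmetric])
  also have "\<dots> \<le> (\<Sum>j<m. - ((\<Sum>i\<in>UNIV. G j i) / sqrt (\<sigma> + S)) + L / 2 * (norm (s j))\<^sup>2)"
  proof (rule sum_mono)
    fix j assume "j \<in> {..<m}"
    then show "f (x (Suc j)) - f (x j)
        \<le> - ((\<Sum>i\<in>UNIV. G j i) / sqrt (\<sigma> + S)) + L / 2 * (norm (s j))\<^sup>2"
      using descent_lemma[OF gradient lipschitz, of "x j" "s j"] first_order[of j]
      by (simp add: next_iterate)
  qed
  also have "\<dots> = - (S / sqrt (\<sigma> + S)) + L / 2 * (\<Sum>j<m. (norm (s j))\<^sup>2)"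
    unfolding sum.distrib sum_negf sum_divide_distrib[symmetric] sum_distrib_left[symmetric] S_def ..
  also have "\<dots> \<le> - (S / sqrt (\<sigma> + S))
      + L / 2 * (real CARD('n) * (ln (1 + S / \<sigma>) + ln (1 + real m * \<kappa>\<^sup>2 / \<sigma>)))"
    using second_order \<open>0 \<le> L\<close> by (intro add_left_mono mult_left_mono) auto
  finally have "S / sqrt (\<sigma> + S) \<le> f (x 0) - f (x m) + real CARD('n) * L / 2 * ln (1 + S / \<sigma>)
      + real CARD('n) * L / 2 * ln (1 + real m * \<kappa>\<^sup>2 / \<sigma>)"
    by (simp add: algebra_simps)
  moreover have "real T * (\<Sum>j<m. (norm (g (x j)))\<^sup>2) \<le> real CARD('n) * S"
    unfolding S_def sum_distrib_left sum_G
    using Opt by (intro sum_mono) (simp add: is_opt_def sum_distrib_left)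
  ultimately show thesis
    using that \<open>0 \<le> S\<close> by blast
qed

theorem theorem2p3:
  fixes f :: "real ^ 'n::finite \<Rightarrow> real"
    and g :: "real ^ 'n \<Rightarrow> real ^ 'n"
    and x :: "nat \<Rightarrow> real ^ 'n"
    and L f_low \<sigma> \<kappa> :: real
    and T k :: nat
  assumes gradient: "\<And>y. GDERIV f y :> g y"
    and continuous: "continuous_on UNIV g"
    and lipschitz: "L-lipschitz_on UNIV g"
    and bounded_below: "\<And>y. f_low \<le> f y"
    and T: "T \<in> {2..CARD('n)}"
    and \<sigma>: "0 < \<sigma>" "\<sigma> < 1" "\<sigma> \<le> (8 * real CARD('n) * L / 3)\<^sup>2"
    and iterates: "prunAdag_iterates g T \<sigma> x"
    and \<kappa>: "0 < \<kappa>" "\<And>i j. \<bar>x j $ i\<bar> \<le> \<kappa>"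
  shows "1 / (real k + 1) * (\<Sum>j=0..k. (norm (g (x j)))\<^sup>2)
         \<le> of_int \<lceil>real CARD('n) / real T\<rceil> *
           (theta CARD('n) L \<sigma> (f (x 0) - f_low) \<kappa> k / (real k + 1))"
proof -
  let ?n = "CARD('n)" and ?\<theta> = "theta CARD('n) L \<sigma> (f (x 0) - f_low) \<kappa> k"
  \<comment> \<open>For \<open>L = 0\<close> the upper bound on \<open>\<sigma>\<close> would be 0,
    against \<open>0 < \<sigma>\<close>.\<close>
  have "L \<noteq> 0" using \<sigma> by auto
  then have "0 < L"
    using lipschitz_on_nonneg[OF lipschitz] by simp
  \<comment> \<open>The average runs over the iterates 0 to \<open>k\<close>, so
    \<open>Suc k\<close> steps are summed, and the last function value is that at
    \<open>x (Suc k)\<close>.\<close>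
  obtain S where S: "real T * (\<Sum>j<Suc k. (norm (g (x j)))\<^sup>2) \<le> real ?n * S" "0 \<le> S"
    and S_le: "S / sqrt (\<sigma> + S) \<le> f (x 0) - f (x (Suc k)) + real ?n * L / 2 * ln (1 + S / \<sigma>)
                             + real ?n * L / 2 * ln (1 + real (Suc k) * \<kappa>\<^sup>2 / \<sigma>)"
    using prunAdag_descent[OF gradient lipschitz \<sigma>(1) iterates \<kappa>(2)] .
  have "S \<le> ?\<theta>"
  proof (rule le_theta)
    show "S / sqrt (\<sigma> + S) \<le> f (x 0) - f_low + real ?n * L / 2 * ln (1 + S / \<sigma>)
        + real ?n * L / 2 * ln (1 + (real k + 1) * \<kappa>\<^sup>2 / \<sigma>)"
      using S_le bounded_below[of "x (Suc k)"] by (simp add: add.commute)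
  qed (use \<open>0 < L\<close> \<sigma> in auto)
  have "(\<Sum>j=0..k. (norm (g (x j)))\<^sup>2) \<le> real ?n / real T * S"
    using S T by (simp add: atLeast0AtMost lessThan_Suc_atMost field_simps)
  \<comment> \<open>Both factors grow: the ratio to its ceiling, and \<open>S\<close> to
    \<open>theta\<close>; \<open>0 \<le> S\<close> supplies the sign needed for multiplying.\<close>
  also have "\<dots> \<le> of_int \<lceil>real ?n / real T\<rceil> * ?\<theta>"
    using \<open>S \<le> ?\<theta>\<close> \<open>0 \<le> S\<close> by (intro mult_mono le_of_int_ceiling) (auto intro: less_le_trans[of _ 0])
  finally show ?thesis
    by (simp add: divide_right_mono)
qed

end
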